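(* For a non-empty dGEC $\mathfrak G=(V,\kappa)$ the following conditions are equivalent: (i) $\mathfrak G$ is a uniquely homogeneous AB-HO dGEC; (ii) there exist a binary operation $*$ on $V$ and a function $\mu\colon V\to Z$ (where $Z$ is some set) such that: • $(V,* )$ is a group; • the function $V\ni v\mapsto(\mu(v),\mu(v^{-1}))\in Z\times Z$ is one-to-one; • $\kappa(u,v)=\mu(u^{-1}*v)$ for any $u,v\in V$. Moreover, (gr1) if (ii) holds, then the automorphism group $\mathrm{Aut}(\mathfrak G)$ consists precisely of all left translations of the group $(V,* )$; in particular, $(V,* )$ is isomorphic to $\mathrm{Aut}(\mathfrak G)$; (gr2) if (i) holds, then for any vertex $u\in V$ there exists a unique pair $( *,\mu)$ such that (ii) holds and $u$ is the neutral element of $(V,* )$.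
   Context: A directed GEC (dGEC) is a pair $\mathfrak G=(V,\kappa)$ where $V$ is a set (of vertices) and $\kappa$ is a function defined on $V\times V$ such that for all $x,y,z\in V$: $\kappa(x,y)=\kappa(z,z)\iff x=y$. A partial morphism of $\mathfrak G$ is a function $f\colon A\to V$ with $A\subset V$ and $\kappa(a,b)=\kappa(f(a),f(b))$ for all $a,b\in A$; an automorphism is a bijective partial morphism of $V$ onto $V$. A dGEC is absolutely homogeneous (AB-HO) if every its partial morphism extends to an automorphism. An AB-HO dGEC is uniquely homogeneous if each its partial morphism defined on a non-empty set of vertices extends to a unique automorphism. In (ii), $v^{-1}$ denotes the inverse in the group $(V,* )$. In (gr2), $\mu$ is considered as a function on $V$ irrespective of the choice of the target set $Z$. *)

theory Defs
  imports "HOL-Algebra.Bij"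
begin

(* The function kappa is defined on V x V; its values outside V x V are never used. *)
definition dGEC :: "'v set \<Rightarrow> ('v \<Rightarrow> 'v \<Rightarrow> 'c) \<Rightarrow> bool" where
  "dGEC V \<kappa> \<longleftrightarrow> (\<forall>x\<in>V. \<forall>y\<in>V. \<forall>z\<in>V. \<kappa> x y = \<kappa> z z \<longleftrightarrow> x = y)"

(* Functions with domain A are represented extensionally (undefined off A), so that equality
   of HOL functions is equality of functions on A, and unique existence has its usual meaning.
   The domain A may be empty or infinite. *)
definition partial_morphism :: "'v set \<Rightarrow> ('v \<Rightarrow> 'v \<Rightarrow> 'c) \<Rightarrow> 'v set \<Rightarrow> ('v \<Rightarrow> 'v) \<Rightarrow> bool" where
  "partial_morphism V \<kappa> A f \<longleftrightarrow>
     A \<subseteq> V \<and> f \<in> A \<rightarrow>\<^sub>E V \<and> (\<forall>a\<in>A. \<forall>b\<in>A. \<kappa> a b = \<kappa> (f a) (f b))"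

definition Aut :: "'v set \<Rightarrow> ('v \<Rightarrow> 'v \<Rightarrow> 'c) \<Rightarrow> ('v \<Rightarrow> 'v) set" where
  "Aut V \<kappa> = {f. partial_morphism V \<kappa> V f \<and> bij_betw f V V}"

definition AutGroup_dGEC :: "'v set \<Rightarrow> ('v \<Rightarrow> 'v \<Rightarrow> 'c) \<Rightarrow> ('v \<Rightarrow> 'v) monoid" where
  "AutGroup_dGEC V \<kappa> = BijGroup V \<lparr>carrier := Aut V \<kappa>\<rparr>"

definition extends_on :: "'v set \<Rightarrow> ('v \<Rightarrow> 'v) \<Rightarrow> ('v \<Rightarrow> 'v) \<Rightarrow> bool" where
  "extends_on A f g \<longleftrightarrow> (\<forall>a\<in>A. g a = f a)"

definition AB_HO :: "'v set \<Rightarrow> ('v \<Rightarrow> 'v \<Rightarrow> 'c) \<Rightarrow> bool" where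
  "AB_HO V \<kappa> \<longleftrightarrow> dGEC V \<kappa> \<and>
     (\<forall>A f. partial_morphism V \<kappa> A f \<longrightarrow> (\<exists>g\<in>Aut V \<kappa>. extends_on A f g))"

definition uniquely_homogeneous :: "'v set \<Rightarrow> ('v \<Rightarrow> 'v \<Rightarrow> 'c) \<Rightarrow> bool" where
  "uniquely_homogeneous V \<kappa> \<longleftrightarrow> AB_HO V \<kappa> \<and>
     (\<forall>A f. partial_morphism V \<kappa> A f \<and> A \<noteq> {} \<longrightarrow>
        (\<exists>!g. g \<in> Aut V \<kappa> \<and> extends_on A f g))"

abbreviation group_str :: "'v set \<Rightarrow> ('v \<Rightarrow> 'v \<Rightarrow> 'v) \<Rightarrow> 'v \<Rightarrow> 'v monoid" where
  "group_str V m e \<equiv> \<lparr>carrier = V, mult = m, one = e\<rparr>"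

(* The binary operation m on V (with neutral element e) and the function mu from V to Z
   represent kappa. Both m and mu are taken extensionally on V. The elements of Z have the type
   of the values of kappa, which is forced by the equation kappa u v = mu (u^-1 * v) and loses
   nothing: taking u = e shows that every value of mu is a value of kappa. *)
definition group_representation ::
  "'v set \<Rightarrow> ('v \<Rightarrow> 'v \<Rightarrow> 'c) \<Rightarrow> ('v \<Rightarrow> 'v \<Rightarrow> 'v) \<Rightarrow> 'v \<Rightarrow> 'c set \<Rightarrow> ('v \<Rightarrow> 'c) \<Rightarrow> bool" where
  "group_representation V \<kappa> m e Z \<mu> \<longleftrightarrow>
     m \<in> V \<rightarrow>\<^sub>E V \<rightarrow>\<^sub>E V \<and>
     \<mu> \<in> V \<rightarrow>\<^sub>E Z \<and>
     group (group_str V m e) \<and>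
     inj_on (\<lambda>v. (\<mu> v, \<mu> (inv\<^bsub>group_str V m e\<^esub> v))) V \<and>
     (\<forall>u\<in>V. \<forall>v\<in>V. \<kappa> u v = \<mu> (m (inv\<^bsub>group_str V m e\<^esub> u) v))"

definition left_translation :: "'v set \<Rightarrow> ('v \<Rightarrow> 'v \<Rightarrow> 'v) \<Rightarrow> 'v \<Rightarrow> 'v \<Rightarrow> 'v" where
  "left_translation V m g = (\<lambda>x\<in>V. m g x)"

end

theory Submission
  imports Defs
begin

text \<open>
  Suppose \<open>\<kappa> u v = \<mu> (u\<inverse> * v)\<close> for a group structure on \<open>V\<close>. Left translations
  preserve \<open>u\<inverse> * v\<close> and hence \<open>\<kappa>\<close>. Conversely, the two values \<open>\<kappa> a b\<close> and \<open>\<kappa> b a\<close> are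
  \<open>\<mu> (a\<inverse> * b)\<close> and \<open>\<mu> ((a\<inverse> * b)\<inverse>)\<close>, so the injectivity condition lets one recover
  \<open>a\<inverse> * b\<close> from them; a partial morphism \<open>f\<close> therefore satisfies
  \<open>f b = f a * a\<inverse> * b\<close>, that is, it is a restriction of a left translation
  (\<open>partial_morphism_is_translation\<close>). Since a left translation is determined by its value at any
  one point, this gives unique homogeneity and the description of the automorphism group.

  Suppose now that unique homogeneity holds, and fix a base point \<open>u\<close>. All values \<open>\<kappa> v v\<close> agree,
  so \<open>u \<mapsto> a\<close> is a partial morphism for every \<open>a\<close>; hence the automorphism group acts simply
  transitively on \<open>V\<close>, and evaluation at \<open>u\<close> transports its multiplication to \<open>V\<close>. With
  \<open>\<mu> v = \<kappa> u v\<close> the representation of \<open>\<kappa>\<close> is its invariance under automorphisms, and the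
  injectivity condition says that \<open>u \<mapsto> u, v \<mapsto> w\<close> can be a partial morphism only for \<open>v = w\<close>, because
  the identity is the only automorphism that fixes \<open>u\<close>.

  There is no choice in this construction: \<open>\<mu>\<close> is forced by \<open>\<mu> v = \<kappa> e v\<close>, and left multiplication
  by \<open>a\<close> has to be the automorphism that takes \<open>e\<close> to \<open>a\<close>.
\<close>

lemma Aut_iff:
  "f \<in> Aut V \<kappa> \<longleftrightarrow>
     f \<in> extensional V \<and> bij_betw f V V \<and> (\<forall>a\<in>V. \<forall>b\<in>V. \<kappa> (f a) (f b) = \<kappa> a b)"
  by (auto simp: Aut_def partial_morphism_def PiE_def dest: bij_betwE)

lemma Aut_compose:
  assumes "f \<in> Aut V \<kappa>" "g \<in> Aut V \<kappa>"
  shows "compose V f g \<in> Aut V \<kappa>"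
  using assms bij_betw_compose[of g V V f V]
  by (auto simp: Aut_iff compose_eq dest: bij_betwE)

lemma Aut_id: "(\<lambda>x\<in>V. x) \<in> Aut V \<kappa>"
  by (auto simp: Aut_iff bij_betw_def inj_on_def)

lemma Aut_inv:
  assumes "f \<in> Aut V \<kappa>"
  shows "restrict (inv_into V f) V \<in> Aut V \<kappa>"
proof -
  have bij: "bij_betw f V V" and pres: "\<And>a b. a \<in> V \<Longrightarrow> b \<in> V \<Longrightarrow> \<kappa> (f a) (f b) = \<kappa> a b"
    using assms by (auto simp: Aut_iff)
  have inV: "inv_into V f a \<in> V" and f_inv: "f (inv_into V f a) = a" if "a \<in> V" for a
    using bij that by (auto simp: bij_betw_def inv_into_into f_inv_into_f)
  have "bij_betw (restrict (inv_into V f) V) V V"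
    using bij_betw_inv_into[OF bij] by simp
  moreover have "\<kappa> (inv_into V f a) (inv_into V f b) = \<kappa> a b" if "a \<in> V" "b \<in> V" for a b
    using pres[OF inV[OF that(1)] inV[OF that(2)]] by (simp add: f_inv that)
  ultimately show ?thesis
    by (simp add: Aut_iff)
qed

section \<open>Edge colourings of groups\<close>

locale group_colouring = group G for G (structure) +
  fixes \<kappa> :: "'a \<Rightarrow> 'a \<Rightarrow> 'c" and \<mu> :: "'a \<Rightarrow> 'c"
  assumes inj: "inj_on (\<lambda>v. (\<mu> v, \<mu> (inv v))) (carrier G)"
    and colour: "\<And>x y. x \<in> carrier G \<Longrightarrow> y \<in> carrier G \<Longrightarrow> \<kappa> x y = \<mu> (inv x \<otimes> y)"
begin

abbreviation V where "V \<equiv> carrier G"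
abbreviation L where "L \<equiv> left_translation V (mult G)"

lemma L_apply: "x \<in> V \<Longrightarrow> L g x = g \<otimes> x"
  by (simp add: left_translation_def)

lemma L_in_Aut:
  assumes "g \<in> V"
  shows "L g \<in> Aut V \<kappa>"
proof -
  have "bij_betw (L g) V V"
    using assms by (intro bij_betwI[where g = "\<lambda>x. inv g \<otimes> x"])
      (auto simp: L_apply m_assoc[symmetric])
  moreover have "inv (g \<otimes> x) \<otimes> (g \<otimes> y) = inv x \<otimes> y" if "x \<in> V" "y \<in> V" for x y
    using assms that by (simp add: inv_mult_group m_assoc inv_solve_left')
  moreover have "L g \<in> extensional V"
    by (simp add: left_translation_def)
  ultimately show ?thesis
    using assms by (simp add: Aut_iff L_apply colour)
qed

lemma quotient_determined:
  assumes "a \<in> V" "b \<in> V" "c \<in> V" "d \<in> V" "\<kappa> a b = \<kappa> c d" "\<kappa> b a = \<kappa> d c"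
  shows "inv a \<otimes> b = inv c \<otimes> d"
proof (rule inj_onD[OF inj])
  have "inv (inv a \<otimes> b) = inv b \<otimes> a" "inv (inv c \<otimes> d) = inv d \<otimes> c"
    using assms by (simp_all add: inv_mult_group)
  then show "(\<mu> (inv a \<otimes> b), \<mu> (inv (inv a \<otimes> b))) = (\<mu> (inv c \<otimes> d), \<mu> (inv (inv c \<otimes> d)))"
    using assms by (simp flip: colour)
qed (use assms in auto)

text \<open>The colours of the two edges between \<open>a\<close> and \<open>b\<close> determine \<open>a\<inverse> * b\<close>, so the image of one
  point fixes the images of all the others.\<close>
lemma partial_morphism_is_translation:
  assumes f: "partial_morphism V \<kappa> A f" and a: "a \<in> A"
  shows "\<forall>b\<in>A. f b = L (f a \<otimes> inv a) b"
proof
  fix b assume b: "b \<in> A"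
  have inV: "a \<in> V" "b \<in> V" "f a \<in> V" "f b \<in> V"
    using f a b by (auto simp: partial_morphism_def)
  have "\<kappa> a b = \<kappa> (f a) (f b)" "\<kappa> b a = \<kappa> (f b) (f a)"
    using f a b by (auto simp: partial_morphism_def)
  from quotient_determined[OF inV this] have "f a \<otimes> (inv a \<otimes> b) = f b"
    using inV by (simp add: inv_solve_left)
  then show "f b = L (f a \<otimes> inv a) b"
    using inV by (simp add: L_apply m_assoc)
qed

lemma Aut_eq_translations: "Aut V \<kappa> = L ` V"
proof (intro equalityI subsetI)
  fix f assume f: "f \<in> Aut V \<kappa>"
  then have *: "\<forall>b\<in>V. f b = L (f \<one> \<otimes> inv \<one>) b"
    by (intro partial_morphism_is_translation) (auto simp: Aut_def)
  have "f \<one> \<in> V" "f \<in> extensional V"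
    using f by (auto simp: Aut_iff dest: bij_betwE)
  moreover have "L (f \<one>) \<in> extensional V"
    by (simp add: left_translation_def)
  moreover have "f b = L (f \<one>) b" if "b \<in> V" for b
    using bspec[OF * that] \<open>f \<one> \<in> V\<close> by simp
  ultimately have "f = L (f \<one>)"
    by (intro extensionalityI[of f V])
  with \<open>f \<one> \<in> V\<close> show "f \<in> L ` V" by blast
qed (auto intro: L_in_Aut)

lemma translation_eqI:
  assumes "g \<in> V" "h \<in> V" "a \<in> V" "L g a = L h a"
  shows "g = h"
  using assms by (simp add: L_apply)

lemma L_iso: "L \<in> iso G (AutGroup_dGEC V \<kappa>)"
proof -
  have Bij: "L g \<in> Bij V" if "g \<in> V" for g
    using L_in_Aut[OF that] by (simp add: Aut_iff Bij_def)
  have "L (g \<otimes> h) = compose V (L g) (L h)" if "g \<in> V" "h \<in> V" for g h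
    by (rule extensionalityI[of _ V])
      (use that in \<open>auto simp: compose_eq L_apply m_assoc left_translation_def\<close>)
  moreover have "inj_on L V"
    by (rule inj_onI, rule translation_eqI[of _ _ \<one>]) auto
  ultimately show ?thesis
    using Bij L_in_Aut
    by (auto simp: iso_def hom_def AutGroup_dGEC_def BijGroup_def bij_betw_def
        Aut_eq_translations)
qed

lemma uniquely_homogeneous:
  assumes "dGEC V \<kappa>"
  shows "uniquely_homogeneous V \<kappa>"
proof -
  have extension: "\<exists>g\<in>Aut V \<kappa>. extends_on A f g"
    if f: "partial_morphism V \<kappa> A f" for A f
  proof (cases "A = {}")
    case True
    then show ?thesis using Aut_id by (auto simp: extends_on_def)
  next
    case False
    then obtain a where a: "a \<in> A" by blast
    then have "f a \<otimes> inv a \<in> V"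
      using f by (auto simp: partial_morphism_def)
    then show ?thesis
      using partial_morphism_is_translation[OF f a] L_in_Aut unfolding extends_on_def by metis
  qed
  moreover have "g = h"
    if f: "partial_morphism V \<kappa> A f" "A \<noteq> {}" and g: "g \<in> Aut V \<kappa>" "extends_on A f g"
      and h: "h \<in> Aut V \<kappa>" "extends_on A f h" for A f g h
  proof -
    obtain a where a: "a \<in> A" "a \<in> V"
      using f by (auto simp: partial_morphism_def)
    have "g a = h a"
      using a g h by (simp add: extends_on_def)
    then show "g = h"
      using g(1) h(1) a(2) translation_eqI unfolding Aut_eq_translations by blast
  qed
  ultimately show ?thesis
    using assms unfolding uniquely_homogeneous_def AB_HO_def by blast
qed

end

lemma group_representation_colouring:
  assumes "group_representation V \<kappa> m e Z \<mu>"
  shows "group_colouring (group_str V m e) \<kappa> \<mu>"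
  using assms
  by (simp add: group_representation_def group_colouring_def group_colouring_axioms_def)

lemma group_representation_mu:
  assumes "group_representation V \<kappa> m e Z \<mu>" "v \<in> V"
  shows "\<mu> v = \<kappa> e v"
proof -
  interpret group_colouring "group_str V m e" \<kappa> \<mu>
    by (rule group_representation_colouring[OF assms(1)])
  show ?thesis
    using colour[of e v] one_closed inv_one l_one[of v] assms(2) by simp
qed

text \<open>Left multiplication by \<open>a\<close> is the automorphism that takes the neutral element to \<open>a\<close>. The
  automorphism group depends only on \<open>\<kappa>\<close>, so the product does too.\<close>
lemma group_representation_unique:
  assumes "group_representation V \<kappa> m e Z \<mu>" "group_representation V \<kappa> m' e Z' \<mu>'"
  shows "m = m' \<and> \<mu> = \<mu>'"
proof
  interpret A: group_colouring "group_str V m e" \<kappa> \<mu>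
    by (rule group_representation_colouring[OF assms(1)])
  interpret B: group_colouring "group_str V m' e" \<kappa> \<mu>'
    by (rule group_representation_colouring[OF assms(2)])
  have m: "m \<in> V \<rightarrow>\<^sub>E V \<rightarrow>\<^sub>E V" and m': "m' \<in> V \<rightarrow>\<^sub>E V \<rightarrow>\<^sub>E V"
    and mu: "\<mu> \<in> extensional V" and mu': "\<mu>' \<in> extensional V"
    using assms by (auto simp: group_representation_def PiE_def)
  have e: "e \<in> V" using A.one_closed by simp
  show "m = m'"
  proof (rule PiE_ext[OF m m'])
    fix a assume a: "a \<in> V"
    have "left_translation V m a \<in> left_translation V m' ` V"
      using A.Aut_eq_translations B.Aut_eq_translations a by auto
    then obtain b where b: "b \<in> V" "left_translation V m a = left_translation V m' b"
      by blast
    have "a = b"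
      using fun_cong[OF b(2), of e] A.r_one[of a] B.r_one[of b] a b(1) e
      by (simp add: left_translation_def)
    with b(2) have eq: "\<And>x. x \<in> V \<Longrightarrow> m a x = m' a x"
      by (metis left_translation_def restrict_apply')
    have "m a \<in> extensional V" "m' a \<in> extensional V"
      using m m' a by (auto simp: PiE_def)
    then show "m a = m' a"
      by (rule extensionalityI) (rule eq)
  qed
  show "\<mu> = \<mu>'"
    using mu mu' by (rule extensionalityI) (simp add: group_representation_mu[OF assms(1)]
        group_representation_mu[OF assms(2)])
qed

section \<open>The group structure of a uniquely homogeneous dGEC\<close>

locale pointed_uniquely_homogeneous =
  fixes V :: "'v set" and \<kappa> :: "'v \<Rightarrow> 'v \<Rightarrow> 'c" and u :: 'v
  assumes unique_hom: "uniquely_homogeneous V \<kappa>" and u: "u \<in> V"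
begin

lemma colour_eq_loop_iff: "x \<in> V \<Longrightarrow> y \<in> V \<Longrightarrow> z \<in> V \<Longrightarrow> \<kappa> x y = \<kappa> z z \<longleftrightarrow> x = y"
  using unique_hom unfolding uniquely_homogeneous_def AB_HO_def dGEC_def by blast

text \<open>Unique homogeneity applied to the one-point morphisms, which exist because all loops
  have the same colour.\<close>
lemma simply_transitive:
  assumes "a \<in> V"
  shows "\<exists>!g. g \<in> Aut V \<kappa> \<and> g u = a"
proof -
  have "partial_morphism V \<kappa> {u} (\<lambda>x\<in>{u}. a)"
    using assms u colour_eq_loop_iff[of u u a] by (auto simp: partial_morphism_def)
  then have "\<exists>!g. g \<in> Aut V \<kappa> \<and> extends_on {u} (\<lambda>x\<in>{u}. a) g"
    using unique_hom unfolding uniquely_homogeneous_def by blast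
  then show ?thesis by (simp add: extends_on_def)
qed

definition T where "T a = (THE g. g \<in> Aut V \<kappa> \<and> g u = a)"

lemma T: "a \<in> V \<Longrightarrow> T a \<in> Aut V \<kappa>" "a \<in> V \<Longrightarrow> T a u = a"
  using theI'[OF simply_transitive] unfolding T_def by blast+

lemma T_unique: "g \<in> Aut V \<kappa> \<Longrightarrow> g u = a \<Longrightarrow> a \<in> V \<Longrightarrow> g = T a"
  using simply_transitive[of a] T[of a] by blast

lemma T_closed: "a \<in> V \<Longrightarrow> b \<in> V \<Longrightarrow> T a b \<in> V"
  using T(1)[of a] by (auto simp: Aut_iff dest: bij_betwE)

lemma T_pres: "a \<in> V \<Longrightarrow> b \<in> V \<Longrightarrow> c \<in> V \<Longrightarrow> \<kappa> (T a b) (T a c) = \<kappa> b c"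
  using T(1)[of a] by (auto simp: Aut_iff)

lemma T_base: "x \<in> V \<Longrightarrow> T u x = x"
  using T_unique[OF Aut_id, of u] u by (metis restrict_apply')

lemma T_T:
  assumes "a \<in> V" "b \<in> V"
  shows "T (T a b) = compose V (T a) (T b)"
  by (rule sym, rule T_unique)
    (use assms u in \<open>auto simp: compose_eq T intro: Aut_compose T_closed\<close>)

lemma T_left_inverse:
  assumes "a \<in> V"
  shows "\<exists>b\<in>V. T b a = u"
proof -
  let ?g = "restrict (inv_into V (T a)) V"
  have g: "?g \<in> Aut V \<kappa>" by (rule Aut_inv[OF T(1)[OF assms]])
  then have gu: "?g u \<in> V" using u by (auto simp: Aut_iff dest: bij_betwE)
  have "inj_on (T a) V" using T(1)[OF assms] by (simp add: Aut_iff bij_betw_def)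
  then have "inv_into V (T a) (T a u) = u" using u by (rule inv_into_f_f)
  then have "?g a = u" using assms T(2)[OF assms] by simp
  with T_unique[OF g refl gu] gu show ?thesis by metis
qed

definition product where "product = (\<lambda>a\<in>V. \<lambda>b\<in>V. T a b)"

lemma product_apply: "a \<in> V \<Longrightarrow> b \<in> V \<Longrightarrow> product a b = T a b"
  by (simp add: product_def)

lemma product_group: "group (group_str V product u)"
proof (rule groupI)
  fix x y z
  assume "x \<in> carrier (group_str V product u)" "y \<in> carrier (group_str V product u)"
    "z \<in> carrier (group_str V product u)"
  then show "x \<otimes>\<^bsub>group_str V product u\<^esub> y \<otimes>\<^bsub>group_str V product u\<^esub> z
      = x \<otimes>\<^bsub>group_str V product u\<^esub> (y \<otimes>\<^bsub>group_str V product u\<^esub> z)"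
    by (simp add: product_apply T_closed T_T compose_eq)
next
  fix x assume "x \<in> carrier (group_str V product u)"
  then show "\<exists>y\<in>carrier (group_str V product u).
      y \<otimes>\<^bsub>group_str V product u\<^esub> x = \<one>\<^bsub>group_str V product u\<^esub>"
    using T_left_inverse[of x] by (auto simp: product_apply)
qed (use u in \<open>auto simp: product_apply T_closed T_base\<close>)

text \<open>If \<open>v\<close> and \<open>w\<close> are joined to \<open>u\<close> in the same way, some automorphism fixes \<open>u\<close> and takes
  \<open>v\<close> to \<open>w\<close>; only the identity fixes \<open>u\<close>.\<close>
lemma determined_by_colours_at_base:
  assumes v: "v \<in> V" and w: "w \<in> V" and eq: "\<kappa> u v = \<kappa> u w" "\<kappa> v u = \<kappa> w u"
  shows "v = w"
proof (cases "v = u")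
  case True
  then show ?thesis using eq(1) colour_eq_loop_iff[of u w u] u w by auto
next
  case False
  let ?f = "\<lambda>x\<in>{u, v}. if x = u then u else w"
  have "partial_morphism V \<kappa> {u, v} ?f"
    using u v w eq False colour_eq_loop_iff[of v v w] by (auto simp: partial_morphism_def)
  then obtain g where g: "g \<in> Aut V \<kappa>" "extends_on {u, v} ?f g"
    using unique_hom unfolding uniquely_homogeneous_def AB_HO_def by blast
  then have "g u = u" "g v = w" using False by (auto simp: extends_on_def)
  with g(1) have "g = T u" using u by (intro T_unique)
  with \<open>g v = w\<close> show ?thesis using T_base[OF v] by simp
qed

lemma representation:
  "group_representation V \<kappa> product u UNIV (\<lambda>v\<in>V. \<kappa> u v)"
proof -
  let ?G = "group_str V product u"
  interpret G: group ?G by (rule product_group)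
  have inV: "inv\<^bsub>?G\<^esub> x \<in> V" if "x \<in> V" for x
    using G.inv_closed[of x] that by simp
  have inv: "T (inv\<^bsub>?G\<^esub> x) x = u" if "x \<in> V" for x
    using G.l_inv[of x] that inV[OF that] by (simp add: product_apply)
  \<comment> \<open>Translating the edge from \<open>x\<close> to \<open>y\<close> by \<open>x\<inverse>\<close> moves its source to the base point.\<close>
  have colour: "\<kappa> u (T (inv\<^bsub>?G\<^esub> x) y) = \<kappa> x y" if "x \<in> V" "y \<in> V" for x y
    using T_pres[OF inV[OF that(1)] that] inv[OF that(1)] that by simp
  have colour_inv: "\<kappa> u (inv\<^bsub>?G\<^esub> x) = \<kappa> x u" if "x \<in> V" for x
    using colour[OF that u] T(2)[OF inV[OF that]] by simp
  show ?thesis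
    unfolding group_representation_def
  proof (intro conjI ballI)
    show "product \<in> V \<rightarrow>\<^sub>E V \<rightarrow>\<^sub>E V"
      by (auto simp: product_def T_closed)
    show "inj_on (\<lambda>v. ((\<lambda>v\<in>V. \<kappa> u v) v, (\<lambda>v\<in>V. \<kappa> u v) (inv\<^bsub>?G\<^esub> v))) V"
      by (rule inj_onI) (auto simp: inV colour_inv intro: determined_by_colours_at_base)
  qed (auto simp: product_group inV product_apply T_closed colour)
qed

end

section \<open>The characterization\<close>

theorem theorem7p19:
  fixes V :: "'v set" and \<kappa> :: "'v \<Rightarrow> 'v \<Rightarrow> 'c"
  assumes "dGEC V \<kappa>" and "V \<noteq> {}"
  shows "(uniquely_homogeneous V \<kappa> \<longleftrightarrow> (\<exists>m e Z \<mu>. group_representation V \<kappa> m e Z \<mu>))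
    \<and> (\<forall>m e Z \<mu>. group_representation V \<kappa> m e Z \<mu> \<longrightarrow>
          Aut V \<kappa> = left_translation V m ` V
          \<and> group_str V m e \<cong> AutGroup_dGEC V \<kappa>)
    \<and> (uniquely_homogeneous V \<kappa> \<longrightarrow>
          (\<forall>u\<in>V. \<exists>!(m, \<mu>). \<exists>Z. group_representation V \<kappa> m u Z \<mu>))"
proof -
  have exists_at: "\<exists>m \<mu> Z. group_representation V \<kappa> m u Z \<mu>"
    if "uniquely_homogeneous V \<kappa>" "u \<in> V" for u
  proof -
    interpret pointed_uniquely_homogeneous V \<kappa> u using that by unfold_locales
    show ?thesis using representation by blast
  qed
  have from_group: "uniquely_homogeneous V \<kappa> \<and> Aut V \<kappa> = left_translation V m ` V
      \<and> group_str V m e \<cong> AutGroup_dGEC V \<kappa>"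
    if "group_representation V \<kappa> m e Z \<mu>" for m e Z \<mu>
  proof -
    interpret group_colouring "group_str V m e" \<kappa> \<mu>
      by (rule group_representation_colouring[OF that])
    show ?thesis
      using uniquely_homogeneous Aut_eq_translations L_iso assms(1) by (auto simp: is_iso_def)
  qed
  have unique_at: "\<exists>!(m, \<mu>). \<exists>Z. group_representation V \<kappa> m u Z \<mu>"
    if hom: "uniquely_homogeneous V \<kappa>" "u \<in> V" for u
  proof -
    obtain m \<mu> Z where rep: "group_representation V \<kappa> m u Z \<mu>"
      using exists_at[OF hom] by blast
    show ?thesis
    proof (rule ex1I[of _ "(m, \<mu>)"])
      fix p assume "case p of (m, \<mu>) \<Rightarrow> \<exists>Z. group_representation V \<kappa> m u Z \<mu>"
      then obtain Z' where "group_representation V \<kappa> (fst p) u Z' (snd p)"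
        by (auto simp: case_prod_unfold)
      from group_representation_unique[OF this rep] show "p = (m, \<mu>)"
        by (simp add: prod_eq_iff)
    qed (use rep in auto)
  qed
  show ?thesis
    using exists_at from_group unique_at assms(2) by blast
qed

end
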